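(* For every integer $s \ge 4$ there is a constant $c_s > 0$ such that for every integer $k \ge 2$, \[ r(s,k) \ge c_s \frac{k^{s-2}}{(\log k)^{2s-6}}. \]
   Context: For positive integers $s,k$, the Ramsey number $r(s,k)$ is the minimum integer $n$ such that every graph on $n$ vertices contains a clique of size $s$ or an independent set of size $k$. $\log$ denotes the natural logarithm. *)

theory Defs
  imports "HOL-Analysis.Analysis"
begin

definition is_graph :: "nat set \<Rightarrow> nat set set \<Rightarrow> bool" where
  "is_graph V E \<longleftrightarrow> (\<forall>e\<in>E. e \<subseteq> V \<and> card e = 2)"

definition is_clique :: "nat set set \<Rightarrow> nat set \<Rightarrow> bool" where
  "is_clique E S \<longleftrightarrow> (\<forall>x\<in>S. \<forall>y\<in>S. x \<noteq> y \<longrightarrow> {x, y} \<in> E)"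

definition is_indep :: "nat set set \<Rightarrow> nat set \<Rightarrow> bool" where
  "is_indep E S \<longleftrightarrow> (\<forall>x\<in>S. \<forall>y\<in>S. x \<noteq> y \<longrightarrow> {x, y} \<notin> E)"

definition ramsey_prop :: "nat \<Rightarrow> nat \<Rightarrow> nat \<Rightarrow> bool" where
  "ramsey_prop s k n \<longleftrightarrow>
     (\<forall>E. is_graph {0..<n} E \<longrightarrow>
        (\<exists>S\<subseteq>{0..<n}. card S = s \<and> is_clique E S) \<or>
        (\<exists>S\<subseteq>{0..<n}. card S = k \<and> is_indep E S))"

definition ramsey_number :: "nat \<Rightarrow> nat \<Rightarrow> nat" where
  "ramsey_number s k = (LEAST n. ramsey_prop s k n)"

end

theory Submission
  imports Defs "HOL-Library.Ramsey" "HOL-Library.Z2" "HOL-Algebra.Algebraic_Closure_Type"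
begin

text \<open>
  Let \<open>q\<close> be a prime power and \<open>d = s - 1\<close>. Map the vertices \<open>0, \<dots>, N - 1\<close> independently at
  random to pairs \<open>(a, \<alpha>)\<close> of vectors in \<open>GF(q)\<^sup>d\<close> with \<open>\<alpha> \<cdot> a \<noteq> 0\<close>, and join \<open>i < j\<close> iff
  \<open>\<alpha>\<^sub>i \<cdot> a\<^sub>j = 0\<close>. On a clique the matrix \<open>(\<alpha>\<^sub>i \<cdot> a\<^sub>j)\<close> is triangular with nonzero diagonal and of
  rank at most \<open>d\<close>, so there is no clique on \<open>d + 1\<close> vertices. An independent set of size \<open>k\<close>
  yields a sequence of \<open>k\<close> pairs with \<open>\<alpha>\<^sub>i \<cdot> a\<^sub>j \<noteq> 0\<close> for \<open>i < j\<close>, and by expansion of the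
  point-hyperplane incidence graph there are only \<open>(O(q\<^sup>d\<^sup>+\<^sup>2))\<^sup>k\<close> of the roughly \<open>q\<^sup>2\<^sup>d\<^sup>k\<close> sequences
  of this kind once \<open>k\<close> is a large multiple of \<open>q (log q)\<^sup>2\<close>. A union bound then
  allows \<open>N\<close> of order \<open>k q\<^sup>d\<^sup>-\<^sup>2\<close>. Taking \<open>q\<close> to be a power of two avoids
  any appeal to the distribution of primes.
\<close>

section \<open>Finite fields of characteristic two\<close>

text \<open>The field is a set inside a larger field type because its size has to grow with the
  Ramsey parameter k, and a type cannot depend on a term.\<close>

locale finite_subfield =
  fixes K :: "'a::field set"
  assumes finite_K: "finite K"
    and one_K: "1 \<in> K"
    and add_K: "x \<in> K \<Longrightarrow> y \<in> K \<Longrightarrow> x + y \<in> K"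
    and uminus_K: "x \<in> K \<Longrightarrow> - x \<in> K"
    and mult_K: "x \<in> K \<Longrightarrow> y \<in> K \<Longrightarrow> x * y \<in> K"
    and inverse_K: "x \<in> K \<Longrightarrow> inverse x \<in> K"

text \<open>Over an algebraically closed field p splits into linear factors. A factor occurring
  twice would give a common root of p and its derivative, so the roots are distinct and there are as
  many as the degree.\<close>

lemma card_proots_eq_degree:
  fixes p :: "'a::alg_closed_field poly"
  assumes "p \<noteq> 0" and "\<And>x. poly p x = 0 \<Longrightarrow> poly (pderiv p) x \<noteq> 0"
  shows "card {x. poly p x = 0} = Polynomial.degree p"
proof -
  obtain A where A: "size A = Polynomial.degree p"
      "p = Polynomial.smult (Polynomial.lead_coeff p) (\<Prod>x\<in>#A. [:-x, 1:])"
    using alg_closed_imp_factorization[OF assms(1)] by blast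
  have roots: "{x. poly p x = 0} = set_mset A"
    by (subst A(2)) (use assms(1) in \<open>auto simp: poly_prod_mset\<close>)
  have "count A x = 1" if x: "x \<in># A" for x
  proof (rule ccontr)
    assume "count A x \<noteq> 1"
    with x have "x \<in># A - {#x#}"
      by (simp add: in_diff_count) (metis One_nat_def count_greater_zero_iff neq0_conv not_less_eq less_one nat_neq_iff)
    then obtain C where C: "A = add_mset x (add_mset x C)"
      using x by (metis insert_DiffM)
    have "p = [:-x, 1:] * ([:-x, 1:] * Polynomial.smult (Polynomial.lead_coeff p) (\<Prod>x\<in>#C. [:-x, 1:]))"
      by (subst A(2)) (simp add: C mult_ac)
    then obtain r where r: "p = [:-x, 1:] * ([:-x, 1:] * r)"
      by blast
    have "poly p x = 0" "poly (pderiv p) x = 0"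
      by (simp_all only: r pderiv_mult poly_mult poly_add) simp_all
    then show False
      using assms(2) by blast
  qed
  then have "size A = card (set_mset A)"
    by (simp add: size_multiset_overloaded_eq)
  then show ?thesis
    using A(1) roots by simp
qed

text \<open>Take the roots of X^q - X with q = 2^m in the algebraic closure of the two-element
  field. They form a subfield because x -> x^q is additive and multiplicative. They are q in number
  because q is even, so the derivative is the constant -1.\<close>

lemma exists_finite_subfield_card_2_power:
  assumes "m > 0"
  shows "\<exists>K :: bit alg_closure set. finite_subfield K \<and> card K = 2 ^ m"
proof -
  define q :: nat where "q = 2 ^ m"
  define K where "K = {x :: bit alg_closure. x ^ q = x}"
  have q: "q > 1" "even q"
    using assms one_less_power[of "2 :: nat" m] by (auto simp: q_def)
  have "to_ac (1 + 1 :: bit) = to_ac 0"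
    by simp
  then have two: "(1 :: bit alg_closure) + 1 = 0"
    by (simp only: to_ac_add to_ac_1 to_ac_0)
  then have two': "(2 :: bit alg_closure) = 0"
    by simp
  have neg: "- x = x" for x :: "bit alg_closure"
    using two' by (metis add_eq_0_iff mult_2 mult_zero_left)
  \<comment> \<open>Squaring is additive in characteristic two; iterate it j times.\<close>
  have frob: "(x + y) ^ (2 ^ j) = x ^ (2 ^ j) + y ^ (2 ^ j)" for x y :: "bit alg_closure" and j
  proof (induction j)
    case (Suc j)
    have "(x + y) ^ (2 ^ Suc j) = ((x + y) ^ (2 ^ j))\<^sup>2"
      by (metis power_Suc2 power_mult)
    also have "\<dots> = (x ^ (2 ^ j))\<^sup>2 + (y ^ (2 ^ j))\<^sup>2"
      by (simp add: Suc.IH power2_sum two')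
    finally show ?case
      by (metis power_Suc2 power_mult)
  qed simp
  define p where "p = Polynomial.monom 1 q - Polynomial.monom (1 :: bit alg_closure) 1"
  have deg: "Polynomial.degree p = q"
    unfolding p_def using q by (subst diff_conv_add_uminus, subst degree_add_eq_left) (simp_all add: degree_monom_eq)
  have "card {x. poly p x = 0} = Polynomial.degree p"
  proof (rule card_proots_eq_degree)
    show "p \<noteq> 0"
      using deg q by auto
    obtain r where "q = 2 * r"
      using q by auto
    then have "of_nat q = (0 :: bit alg_closure)"
      by (simp add: two')
    then show "poly (pderiv p) x \<noteq> 0" for x
      by (simp add: p_def pderiv_diff pderiv_monom)
  qed
  moreover have "{x. poly p x = 0} = K"
    by (auto simp: p_def K_def poly_monom)
  ultimately have card: "card K = q"
    using deg by simp
  have "finite_subfield K"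
  proof
    show "finite K"
      using card q by (metis card.infinite not_less_zero)
  qed (use neg q frob[of _ _ m] in \<open>auto simp: K_def q_def power_mult_distrib power_inverse\<close>)
  with card show ?thesis
    unfolding q_def by blast
qed

section \<open>Hyperplanes over a finite field\<close>

definition dot :: "nat \<Rightarrow> (nat \<Rightarrow> 'a) \<Rightarrow> (nat \<Rightarrow> 'a) \<Rightarrow> 'a::comm_semiring_0" where
  "dot d a b = (\<Sum>i<d. a i * b i)"

context finite_subfield
begin

definition vecs :: "nat \<Rightarrow> (nat \<Rightarrow> 'a) set" where
  "vecs d = {..<d} \<rightarrow>\<^sub>E K"

lemma zero_K: "0 \<in> K"
  using add_K[OF one_K uminus_K[OF one_K]] by simp

lemma divide_K: "x \<in> K \<Longrightarrow> y \<in> K \<Longrightarrow> x / y \<in> K"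
  using mult_K[of x "inverse y"] inverse_K by (simp add: divide_inverse)

lemma sum_K: "(\<And>i. i \<in> I \<Longrightarrow> f i \<in> K) \<Longrightarrow> sum f I \<in> K"
  by (induction I rule: infinite_finite_induct) (auto simp: zero_K add_K)

lemma card_K_ge_2: "card K \<ge> 2"
  using card_mono[OF finite_K, of "{0, 1}"] zero_K one_K by simp

lemma finite_vecs: "finite (vecs d)"
  unfolding vecs_def by (intro finite_PiE) (auto simp: finite_K)

lemma card_vecs: "card (vecs d) = card K ^ d"
  unfolding vecs_def by (simp add: card_PiE)

lemma vecs_in_K: "a \<in> vecs d \<Longrightarrow> i < d \<Longrightarrow> a i \<in> K"
  by (auto simp: vecs_def)

text \<open>Since \<open>a i\<close> is nonzero, the equation can be solved for coordinate i: the
  other d - 1 coordinates are free and determine it. Two injections, one in each direction, make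
  this precise.\<close>

lemma card_hyperplane:
  assumes a: "a \<in> vecs d" and i: "i < d" "a i \<noteq> 0"
  shows "card {\<alpha> \<in> vecs d. dot d \<alpha> a = 0} = card K ^ (d - 1)"
proof -
  define J where "J = {..<d} - {i}"
  define H where "H = {\<alpha> \<in> vecs d. dot d \<alpha> a = 0}"
  have split: "dot d \<alpha> a = \<alpha> i * a i + (\<Sum>j\<in>J. \<alpha> j * a j)" for \<alpha>
    unfolding dot_def J_def using i by (subst sum.remove[of _ i]) auto
  have J: "finite J" "card J = d - 1"
    using i by (simp_all add: J_def)
  have fin: "finite (J \<rightarrow>\<^sub>E K)" "finite H"
    using J finite_vecs by (auto intro!: finite_PiE simp: finite_K H_def)
  have "card H \<le> card (J \<rightarrow>\<^sub>E K)"
  proof (rule card_inj_on_le[where f = "\<lambda>\<alpha>. restrict \<alpha> J"])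
    show "inj_on (\<lambda>\<alpha>. restrict \<alpha> J) H"
    proof
      fix \<alpha> \<beta> assume *: "\<alpha> \<in> H" "\<beta> \<in> H" "restrict \<alpha> J = restrict \<beta> J"
      have eq: "\<alpha> j = \<beta> j" if "j \<in> J" for j
        using *(3) that by (metis restrict_apply)
      have "(\<Sum>j\<in>J. \<alpha> j * a j) = (\<Sum>j\<in>J. \<beta> j * a j)"
        by (rule sum.cong) (auto simp: eq)
      moreover have "dot d \<alpha> a = dot d \<beta> a"
        using * by (simp add: H_def)
      ultimately have "\<alpha> i * a i = \<beta> i * a i"
        by (simp add: split)
      with i have "\<alpha> i = \<beta> i"
        by simp
      with eq * show "\<alpha> = \<beta>"
        by (intro PiE_ext[of _ "{..<d}" "\<lambda>_. K"]) (auto simp: J_def H_def vecs_def)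
    qed
    show "(\<lambda>\<alpha>. restrict \<alpha> J) ` H \<subseteq> J \<rightarrow>\<^sub>E K"
      by (intro image_subsetI) (use vecs_in_K in \<open>auto simp only: restrict_PiE_iff H_def J_def\<close>)
  qed (use fin in blast)
  \<comment> \<open>The extension puts into coordinate i the one value that makes the dot product
    with a vanish.\<close>
  moreover have "card (J \<rightarrow>\<^sub>E K) \<le> card H"
  proof (rule card_inj_on_le[where f = "\<lambda>\<beta>. \<beta>(i := - (\<Sum>j\<in>J. \<beta> j * a j) / a i)"])
    show "inj_on (\<lambda>\<beta>. \<beta>(i := - (\<Sum>j\<in>J. \<beta> j * a j) / a i)) (J \<rightarrow>\<^sub>E K)"
    proof
      fix \<beta> \<gamma> assume *: "\<beta> \<in> J \<rightarrow>\<^sub>E K" "\<gamma> \<in> J \<rightarrow>\<^sub>E K"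
        "\<beta>(i := - (\<Sum>j\<in>J. \<beta> j * a j) / a i) = \<gamma>(i := - (\<Sum>j\<in>J. \<gamma> j * a j) / a i)"
      show "\<beta> = \<gamma>"
      proof (rule PiE_ext[OF *(1,2)])
        fix j assume "j \<in> J"
        then have "j \<noteq> i"
          by (auto simp: J_def)
        with fun_cong[OF *(3), of j] show "\<beta> j = \<gamma> j"
          by simp
      qed
    qed
    show "(\<lambda>\<beta>. \<beta>(i := - (\<Sum>j\<in>J. \<beta> j * a j) / a i)) ` (J \<rightarrow>\<^sub>E K) \<subseteq> H"
    proof (rule image_subsetI)
      fix \<beta> assume \<beta>: "\<beta> \<in> J \<rightarrow>\<^sub>E K"
      define c where "c = - (\<Sum>j\<in>J. \<beta> j * a j) / a i"
      have "\<beta> j * a j \<in> K" if "j \<in> J" for j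
        using that \<beta> vecs_in_K[OF a] by (intro mult_K) (auto simp: J_def)
      then have "c \<in> K"
        unfolding c_def using vecs_in_K[OF a] i by (intro divide_K uminus_K sum_K) auto
      then have "\<beta>(i := c) \<in> vecs d"
        using \<beta> i by (auto simp: vecs_def J_def PiE_iff extensional_def)
      moreover have "(\<Sum>j\<in>J. (\<beta>(i := c)) j * a j) = (\<Sum>j\<in>J. \<beta> j * a j)"
        by (rule sum.cong) (auto simp: J_def)
      then have "dot d (\<beta>(i := c)) a = 0"
        using i by (simp add: split c_def)
      ultimately show "\<beta>(i := c) \<in> H"
        by (simp add: H_def)
    qed
  qed (use fin in auto)
  ultimately show ?thesis
    using J by (simp add: H_def card_PiE)
qed

text \<open>A nonzero 2x2 minor of (a, b) allows coordinates i and j of a common solution to be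
  recovered from the remaining d - 2. The upper bound suffices for the second moment.\<close>

lemma card_codim_2_le:
  assumes ij: "i < d" "j < d" "a i * b j \<noteq> a j * b i"
  shows "card {\<alpha> \<in> vecs d. dot d \<alpha> a = 0 \<and> dot d \<alpha> b = 0} \<le> card K ^ (d - 2)"
proof -
  define J where "J = {..<d} - {i, j}"
  define H where "H = {\<alpha> \<in> vecs d. dot d \<alpha> a = 0 \<and> dot d \<alpha> b = 0}"
  have neq: "i \<noteq> j"
    using ij by auto
  have split: "dot d \<alpha> c = \<alpha> i * c i + \<alpha> j * c j + (\<Sum>l\<in>J. \<alpha> l * c l)" for \<alpha> c
  proof -
    have "{..<d} - {i} - {j} = J"
      by (auto simp: J_def)
    then show ?thesis
      unfolding dot_def using ij neq
      by (subst sum.remove[of _ i], simp, simp, subst sum.remove[of _ j]) (auto simp: add.assoc)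
  qed
  have J: "finite J" "card J = d - 2"
    using ij neq by (simp_all add: J_def card_Diff_subset)
  have fin: "finite (J \<rightarrow>\<^sub>E K)"
    using J by (auto intro!: finite_PiE simp: finite_K)
  have "card H \<le> card (J \<rightarrow>\<^sub>E K)"
  proof (rule card_inj_on_le[where f = "\<lambda>\<alpha>. restrict \<alpha> J"])
    show "inj_on (\<lambda>\<alpha>. restrict \<alpha> J) H"
    proof
      fix \<alpha> \<beta> assume *: "\<alpha> \<in> H" "\<beta> \<in> H" "restrict \<alpha> J = restrict \<beta> J"
      have eq: "\<alpha> l = \<beta> l" if "l \<in> J" for l
        using *(3) that by (metis restrict_apply)
      have sums: "(\<Sum>l\<in>J. \<alpha> l * c l) = (\<Sum>l\<in>J. \<beta> l * c l)" for c :: "nat \<Rightarrow> 'a"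
        by (rule sum.cong) (auto simp: eq)
      define x y where "x = \<alpha> i - \<beta> i" and "y = \<alpha> j - \<beta> j"
      have "dot d \<alpha> a = dot d \<beta> a" "dot d \<alpha> b = dot d \<beta> b"
        using * by (simp_all add: H_def)
      then have xy: "x * a i + y * a j = 0" "x * b i + y * b j = 0"
        unfolding split sums x_def y_def by (simp_all add: algebra_simps)
      \<comment> \<open>Cramer's rule with the denominator cleared: the minor times x, and times y,
        is a combination of the two vanishing expressions in \<open>xy\<close>.\<close>
      have "x * (a i * b j - a j * b i) = b j * (x * a i + y * a j) - a j * (x * b i + y * b j)"
           "y * (a i * b j - a j * b i) = a i * (x * b i + y * b j) - b i * (x * a i + y * a j)"
        by (simp_all add: algebra_simps)
      then have "x * (a i * b j - a j * b i) = 0" "y * (a i * b j - a j * b i) = 0"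
        unfolding xy by simp_all
      then have "\<alpha> i = \<beta> i" "\<alpha> j = \<beta> j"
        using ij by (simp_all add: x_def y_def)
      with eq * show "\<alpha> = \<beta>"
        by (intro PiE_ext[of _ "{..<d}" "\<lambda>_. K"]) (auto simp: J_def H_def vecs_def)
    qed
    show "(\<lambda>\<alpha>. restrict \<alpha> J) ` H \<subseteq> J \<rightarrow>\<^sub>E K"
      by (intro image_subsetI) (use vecs_in_K in \<open>auto simp only: restrict_PiE_iff H_def J_def\<close>)
  qed (use fin in blast)
  then show ?thesis
    using J by (simp add: H_def card_PiE)
qed

text \<open>If all 2x2 minors vanish then b is a scalar multiple of a and is determined by
  \<open>b i\<close>. These are exactly the vectors b to which \<open>card_codim_2_le\<close> does
  not apply.\<close>

lemma card_parallel_le: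
  assumes a: "i < d" "a i \<noteq> 0"
  shows "card {b \<in> vecs d. \<forall>i<d. \<forall>j<d. a i * b j = a j * b i} \<le> card K"
proof (rule card_inj_on_le[where f = "\<lambda>b. b i"])
  show "inj_on (\<lambda>b. b i) {b \<in> vecs d. \<forall>i<d. \<forall>j<d. a i * b j = a j * b i}"
  proof
    fix b c assume *: "b \<in> {b \<in> vecs d. \<forall>i<d. \<forall>j<d. a i * b j = a j * b i}"
      "c \<in> {b \<in> vecs d. \<forall>i<d. \<forall>j<d. a i * b j = a j * b i}" "b i = c i"
    show "b = c"
    proof (rule PiE_ext)
      show "b \<in> {..<d} \<rightarrow>\<^sub>E K" "c \<in> {..<d} \<rightarrow>\<^sub>E K"
        using *(1,2) unfolding vecs_def by blast+
    next
      fix j assume "j \<in> {..<d}"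
      then have "a i * b j = a j * b i" "a i * c j = a j * c i"
        using * a by blast+
      then have "a i * b j = a i * c j"
        using *(3) by simp
      with a show "b j = c j"
        by simp
    qed
  qed
  show "(\<lambda>b. b i) ` {b \<in> vecs d. \<forall>i<d. \<forall>j<d. a i * b j = a j * b i} \<subseteq> K"
    using vecs_in_K a(1) by blast
qed (rule finite_K)

text \<open>The second moment method for the number of \<open>a \<in> A\<close> lying on a random hyperplane.\<close>

lemma card_poor_hyperplanes:
  assumes d: "d \<ge> 2" and A: "A \<subseteq> vecs d" "\<And>a. a \<in> A \<Longrightarrow> \<exists>i<d. a i \<noteq> 0"
  shows "real (card {\<alpha> \<in> vecs d. 2 * card K * card {a \<in> A. dot d \<alpha> a = 0} < card A}) * card A
           \<le> 4 * real (card K) ^ (d + 2)"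
proof -
  define q where "q = real (card K)"
  define n where "n = real (card A)"
  define Z where "Z \<alpha> = real (card {a \<in> A. dot d \<alpha> a = 0})" for \<alpha>
  define B where "B = {\<alpha> \<in> vecs d. 2 * card K * card {a \<in> A. dot d \<alpha> a = 0} < card A}"
  have q: "q \<ge> 2"
    using card_K_ge_2 by (simp add: q_def)
  have finA: "finite A"
    using A finite_vecs finite_subset by blast
  have qd: "q ^ d = q\<^sup>2 * q ^ (d - 2)" "q ^ d = q * q ^ (d - 1)"
    using d by (metis le_add_diff_inverse power_add, metis power_eq_if not_numeral_le_zero)
  have Z_sum: "Z \<alpha> = (\<Sum>a\<in>A. of_bool (dot d \<alpha> a = 0))" for \<alpha>
    using finA by (simp add: Z_def Int_def)
  have hyp: "(\<Sum>\<alpha>\<in>vecs d. of_bool (dot d \<alpha> a = 0)) = q ^ (d - 1)" if a: "a \<in> A" for a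
  proof -
    obtain i where "i < d" "a i \<noteq> 0"
      using A(2)[OF a] by blast
    then have "card {\<alpha> \<in> vecs d. dot d \<alpha> a = 0} = card K ^ (d - 1)"
      using a A(1) by (intro card_hyperplane) auto
    then show ?thesis
      using finite_vecs[of d] by (simp add: q_def Int_def)
  qed
  have Z1: "(\<Sum>\<alpha>\<in>vecs d. Z \<alpha>) = n * q ^ (d - 1)"
    unfolding Z_sum by (subst sum.swap) (simp add: hyp n_def)
  \<comment> \<open>Split A into the set P of multiples of a and the rest. P has at most q elements,
    each contributing at most q^(d-1), hence q^d together; every other b contributes at most
    q^(d-2).\<close>
  have pair: "(\<Sum>b\<in>A. \<Sum>\<alpha>\<in>vecs d. of_bool (dot d \<alpha> a = 0) * of_bool (dot d \<alpha> b = 0))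
      \<le> q ^ d + n * q ^ (d - 2)" (is "(\<Sum>b\<in>A. ?f b) \<le> _") if a: "a \<in> A" for a
  proof -
    obtain i where i: "i < d" "a i \<noteq> 0"
      using A(2)[OF a] by blast
    define P where "P = {b \<in> A. \<forall>i<d. \<forall>j<d. a i * b j = a j * b i}"
    have "?f b \<le> q ^ (d - 1)" for b
      unfolding hyp[OF a, symmetric] by (intro sum_mono) auto
    then have "(\<Sum>b\<in>P. ?f b) \<le> real (card P) * q ^ (d - 1)"
      by (intro sum_bounded_above) auto
    also have "real (card P) \<le> q"
      unfolding q_def P_def using A finite_vecs[of d] card_parallel_le[of i d a, OF i]
      by (intro of_nat_mono order.trans[OF card_mono card_parallel_le[of i d a, OF i]]) auto
    finally have 1: "(\<Sum>b\<in>P. ?f b) \<le> q ^ d"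
      using q qd by (simp add: mult_right_mono)
    have "?f b \<le> q ^ (d - 2)" if b: "b \<in> A - P" for b
    proof -
      obtain i j where "i < d" "j < d" "a i * b j \<noteq> a j * b i"
        using b by (auto simp: P_def)
      then have "card {\<alpha> \<in> vecs d. dot d \<alpha> a = 0 \<and> dot d \<alpha> b = 0} \<le> card K ^ (d - 2)"
        by (rule card_codim_2_le)
      then have "real (card {\<alpha> \<in> vecs d. dot d \<alpha> a = 0 \<and> dot d \<alpha> b = 0}) \<le> q ^ (d - 2)"
        unfolding q_def by (simp only: of_nat_power[symmetric] of_nat_le_iff)
      then show ?thesis
        using finite_vecs[of d] unfolding of_bool_conj[symmetric]
        by (simp add: Int_def del: of_bool_conj)
    qed
    then have "(\<Sum>b\<in>A - P. ?f b) \<le> real (card (A - P)) * q ^ (d - 2)"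
      by (intro sum_bounded_above) auto
    also have "\<dots> \<le> n * q ^ (d - 2)"
      unfolding n_def using finA q by (intro mult_right_mono) (auto intro: card_mono)
    finally have 2: "(\<Sum>b\<in>A - P. ?f b) \<le> n * q ^ (d - 2)" .
    have "(\<Sum>b\<in>A. ?f b) = (\<Sum>b\<in>A - P. ?f b) + (\<Sum>b\<in>P. ?f b)"
      using finA by (intro sum.subset_diff) (auto simp: P_def)
    with 1 2 show ?thesis
      by simp
  qed
  have "(\<Sum>\<alpha>\<in>vecs d. (Z \<alpha>)\<^sup>2)
      = (\<Sum>\<alpha>\<in>vecs d. \<Sum>a\<in>A. \<Sum>b\<in>A. of_bool (dot d \<alpha> a = 0) * of_bool (dot d \<alpha> b = 0))"
    unfolding Z_sum power2_eq_square sum_product ..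
  also have "\<dots> = (\<Sum>a\<in>A. \<Sum>\<alpha>\<in>vecs d. \<Sum>b\<in>A. of_bool (dot d \<alpha> a = 0) * of_bool (dot d \<alpha> b = 0))"
    by (rule sum.swap)
  also have "\<dots> = (\<Sum>a\<in>A. \<Sum>b\<in>A. \<Sum>\<alpha>\<in>vecs d. of_bool (dot d \<alpha> a = 0) * of_bool (dot d \<alpha> b = 0))"
    by (intro sum.cong refl sum.swap)
  also have "\<dots> \<le> n * (q ^ d + n * q ^ (d - 2))"
    unfolding n_def by (intro sum_bounded_above pair[unfolded n_def])
  finally have Z2: "(\<Sum>\<alpha>\<in>vecs d. (Z \<alpha>)\<^sup>2) \<le> n * (q ^ d + n * q ^ (d - 2))" .
  \<comment> \<open>The average of Z is n/q, so this is q^2 times an unnormalised variance. The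
    terms of order n^2 q^d cancel and only the diagonal contribution n q^(d+2) survives.\<close>
  have "(\<Sum>\<alpha>\<in>vecs d. (n - q * Z \<alpha>)\<^sup>2)
      = (\<Sum>\<alpha>\<in>vecs d. n\<^sup>2 - 2 * n * q * Z \<alpha> + q\<^sup>2 * (Z \<alpha>)\<^sup>2)"
    by (intro sum.cong) (auto simp: power2_eq_square algebra_simps)
  also have "\<dots> = q ^ d * n\<^sup>2 - 2 * n * q * (\<Sum>\<alpha>\<in>vecs d. Z \<alpha>) + q\<^sup>2 * (\<Sum>\<alpha>\<in>vecs d. (Z \<alpha>)\<^sup>2)"
    by (simp add: sum.distrib sum_subtractf sum_distrib_left card_vecs q_def)
  also have "\<dots> \<le> q ^ d * n\<^sup>2 - 2 * n * q * (n * q ^ (d - 1)) + q\<^sup>2 * (n * (q ^ d + n * q ^ (d - 2)))"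
    unfolding Z1 using Z2 by (simp add: mult_left_mono)
  also have "\<dots> = n * q ^ (d + 2)"
  proof -
    have "2 * n * q * (n * q ^ (d - 1)) = 2 * n\<^sup>2 * q ^ d"
      using qd(2) by (simp add: power2_eq_square)
    moreover have "q\<^sup>2 * (n * (q ^ d + n * q ^ (d - 2))) = n * q ^ (d + 2) + n\<^sup>2 * q ^ d"
      using qd(1) by (simp add: power2_eq_square power_add algebra_simps)
    ultimately show ?thesis
      by simp
  qed
  finally have upper: "(\<Sum>\<alpha>\<in>vecs d. (n - q * Z \<alpha>)\<^sup>2) \<le> n * q ^ (d + 2)" .
  \<comment> \<open>Chebyshev: for \<alpha> in B, q * Z is below n/2, so the deviation from n is at
    least n/2.\<close>
  have "real (card B) * (n / 2)\<^sup>2 = (\<Sum>\<alpha>\<in>B. (n / 2)\<^sup>2)"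
    by simp
  also have "\<dots> \<le> (\<Sum>\<alpha>\<in>B. (n - q * Z \<alpha>)\<^sup>2)"
  proof (intro sum_mono power_mono)
    fix \<alpha> assume "\<alpha> \<in> B"
    then have "real (2 * card K * card {a \<in> A. dot d \<alpha> a = 0}) < real (card A)"
      by (simp only: B_def of_nat_less_iff) simp
    then show "n / 2 \<le> n - q * Z \<alpha>"
      by (simp add: n_def q_def Z_def)
  qed (simp add: n_def)
  also have "\<dots> \<le> (\<Sum>\<alpha>\<in>vecs d. (n - q * Z \<alpha>)\<^sup>2)"
    using finite_vecs by (intro sum_mono2) (auto simp: B_def)
  finally have "real (card B) * n * n \<le> 4 * q ^ (d + 2) * n"
    using upper by (simp add: power2_eq_square field_simps)
  then have "real (card B) * n \<le> 4 * q ^ (d + 2)"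
    using q by (cases "n = 0") (auto simp: n_def)
  then show ?thesis
    by (simp add: B_def n_def q_def)
qed

end

section \<open>Sequences of pairs avoiding incidences\<close>

context finite_subfield
begin

definition nonzero_vecs :: "nat \<Rightarrow> (nat \<Rightarrow> 'a) set" where
  "nonzero_vecs d = {a \<in> vecs d. \<exists>i<d. a i \<noteq> 0}"

text \<open>Non-incident point-hyperplane pairs, represented by vectors without dividing out
  scalars. Non-incidence already forces both vectors to be nonzero.\<close>

definition antiflags :: "nat \<Rightarrow> ((nat \<Rightarrow> 'a) \<times> (nat \<Rightarrow> 'a)) set" where
  "antiflags d = {x \<in> vecs d \<times> vecs d. dot d (snd x) (fst x) \<noteq> 0}"

text \<open>Lists are used because the condition is not symmetric: it pairs an earlier hyperplane
  with a later point. The set A of admissible points is a parameter so that it can shrink during the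
  induction on t.\<close>

definition avoiding :: "nat \<Rightarrow> nat \<Rightarrow> (nat \<Rightarrow> 'a) set \<Rightarrow> ((nat \<Rightarrow> 'a) \<times> (nat \<Rightarrow> 'a)) list set" where
  "avoiding d t A = {xs. set xs \<subseteq> antiflags d \<inter> A \<times> UNIV \<and> length xs = t \<and>
     sorted_wrt (\<lambda>x y. dot d (snd x) (fst y) \<noteq> 0) xs}"

lemma fst_antiflags: "x \<in> antiflags d \<Longrightarrow> fst x \<in> nonzero_vecs d"
  by (force simp: antiflags_def nonzero_vecs_def dot_def intro!: sum.neutral)

lemma finite_antiflags: "finite (antiflags d)"
  by (rule finite_subset[of _ "vecs d \<times> vecs d"]) (auto simp: antiflags_def finite_vecs)

lemma finite_avoiding: "finite (avoiding d t A)"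
  by (rule finite_subset[OF _ finite_lists_length_eq[OF finite_antiflags[of d], of t]])
    (auto simp: avoiding_def)

lemma card_nonzero_vecs: "card (nonzero_vecs d) + 1 = card K ^ d"
proof -
  define z where "z = (\<lambda>i\<in>{..<d}. 0 :: 'a)"
  have z: "z \<in> vecs d"
    using zero_K unfolding z_def vecs_def restrict_PiE_iff by simp
  have "vecs d = insert z (nonzero_vecs d)"
  proof (intro equalityI subsetI)
    fix a assume a: "a \<in> vecs d"
    show "a \<in> insert z (nonzero_vecs d)"
    proof (cases "\<exists>i<d. a i \<noteq> 0")
      case False
      have "a = z"
        by (rule PiE_ext[OF a[unfolded vecs_def] z[unfolded vecs_def]]) (use False in \<open>simp add: z_def\<close>)
      then show ?thesis
        by simp
    qed (use a in \<open>auto simp: nonzero_vecs_def\<close>)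
  next
    fix a assume "a \<in> insert z (nonzero_vecs d)"
    then show "a \<in> vecs d"
      using z by (auto simp: nonzero_vecs_def)
  qed
  moreover have "z \<notin> nonzero_vecs d" "finite (nonzero_vecs d)"
    using finite_vecs by (auto simp: nonzero_vecs_def z_def)
  ultimately show ?thesis
    using card_vecs[of d] by simp
qed

lemma card_antiflags_le: "card (antiflags d) \<le> card K ^ (2 * d)"
proof -
  have "card (antiflags d) \<le> card (vecs d \<times> vecs d)"
    by (intro card_mono) (auto simp: antiflags_def finite_vecs)
  then show ?thesis
    by (simp add: card_cartesian_product card_vecs mult_2 power_add)
qed

text \<open>The factor 4 is 2 * 2: at least half of all vectors are nonzero, and for each nonzero a
  at least half of all \<alpha> lie off the hyperplane of a, since q is at least 2.\<close>

lemma card_antiflags_ge: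
  assumes "d > 0"
  shows "card K ^ (2 * d) \<le> 4 * card (antiflags d)"
proof -
  define q where "q = card K"
  have q: "q \<ge> 2"
    using card_K_ge_2 by (simp add: q_def)
  have qd: "q ^ d = q * q ^ (d - 1)"
    using assms by (metis power_eq_if less_numeral_extra(3))
  have pos: "q ^ (d - 1) \<ge> 1"
    using q by simp
  have half: "q ^ d \<le> 2 * card {\<alpha> \<in> vecs d. dot d \<alpha> a \<noteq> 0}" if "a \<in> nonzero_vecs d" for a
  proof -
    have "card {\<alpha> \<in> vecs d. dot d \<alpha> a = 0} = q ^ (d - 1)"
      using that card_hyperplane unfolding q_def nonzero_vecs_def by blast
    moreover have "card (vecs d) = card {\<alpha> \<in> vecs d. dot d \<alpha> a = 0} + card {\<alpha> \<in> vecs d. dot d \<alpha> a \<noteq> 0}"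
      using finite_vecs[of d] by (subst card_Un_disjoint[symmetric]) (auto intro: arg_cong[where f = card])
    moreover have "2 * q ^ (d - 1) \<le> q ^ d"
      using q qd by simp
    ultimately show ?thesis
      by (simp add: card_vecs q_def)
  qed
  have "card (nonzero_vecs d) * q ^ d = (\<Sum>a\<in>nonzero_vecs d. q ^ d)"
    by simp
  also have "\<dots> \<le> (\<Sum>a\<in>nonzero_vecs d. 2 * card {\<alpha> \<in> vecs d. dot d \<alpha> a \<noteq> 0})"
    by (intro sum_mono half)
  also have "\<dots> = 2 * card (SIGMA a:nonzero_vecs d. {\<alpha> \<in> vecs d. dot d \<alpha> a \<noteq> 0})"
    using finite_vecs[of d] by (subst card_SigmaI) (auto simp: nonzero_vecs_def sum_distrib_left)
  also have "\<dots> \<le> 2 * card (antiflags d)"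
    by (intro mult_left_mono card_mono finite_antiflags) (auto simp: antiflags_def nonzero_vecs_def)
  finally have "card (nonzero_vecs d) * q ^ d \<le> 2 * card (antiflags d)" .
  moreover have "q ^ d \<le> 2 * card (nonzero_vecs d)"
    using card_nonzero_vecs[of d] q qd pos
      mult_mono[OF q pos] by (simp add: q_def)
  then have "q ^ d * q ^ d \<le> 2 * card (nonzero_vecs d) * q ^ d"
    by (rule mult_right_mono) simp
  moreover have "q ^ (2 * d) = q ^ d * q ^ d"
    by (simp add: mult_2 power_add)
  ultimately show ?thesis
    unfolding q_def by linarith
qed

text \<open>Build the sequence from the left, keeping track of the set \<open>A\<close> of vectors on none of
  the hyperplanes used so far. A next pair \<open>(a, \<alpha>)\<close> with \<open>\<alpha>\<close> poor can be chosen in only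
  \<open>4q\<^sup>d\<^sup>+\<^sup>2\<close> ways; any other choice shrinks the potential \<open>(1 + |A|)\<^sup>\<theta>\<close> by the factor
  \<open>q\<^sup>-\<^sup>2\<^sup>d\<close>, which pays for all of its at most \<open>q\<^sup>2\<^sup>d\<close> possibilities.\<close>

lemma card_avoiding_le:
  assumes d: "d \<ge> 2" and \<theta>: "real (card K) ^ (2 * d) * (1 - 1 / (4 * real (card K))) ^ \<theta> \<le> 1"
    and A: "A \<subseteq> nonzero_vecs d"
  shows "real (card (avoiding d t A)) \<le> (5 * real (card K) ^ (d + 2)) ^ t * (1 + real (card A)) ^ \<theta>"
  using A
proof (induction t arbitrary: A)
  case 0
  have "avoiding d 0 A \<subseteq> {[]}"
    by (auto simp: avoiding_def)
  then have "real (card (avoiding d 0 A)) \<le> 1"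
    using card_mono[of "{[]}" "avoiding d 0 A"] by simp
  also have "1 \<le> (1 + real (card A)) ^ \<theta>"
    by (rule one_le_power) simp
  finally show ?case
    by simp
next
  case (Suc t)
  define q where "q = real (card K)"
  define M where "M = 5 * q ^ (d + 2)"
  define rest where "rest x = {a \<in> A. dot d (snd x) a \<noteq> 0}" for x :: "(nat \<Rightarrow> 'a) \<times> (nat \<Rightarrow> 'a)"
  define F where "F = {x \<in> antiflags d. fst x \<in> A}"
  define B where "B = {\<alpha> \<in> vecs d. 2 * card K * card {a \<in> A. dot d \<alpha> a = 0} < card A}"
  define P where "P = {x \<in> F. snd x \<in> B}"
  have q: "q \<ge> 2"
    using card_K_ge_2 by (simp add: q_def)
  have M: "M \<ge> 0"
    using q by (simp add: M_def)
  have fin: "finite A" "finite B" "finite F"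
    using Suc.prems finite_vecs[of d] finite_antiflags[of d]
    by (auto simp: nonzero_vecs_def B_def F_def intro: finite_subset)
  have IH: "real (card (avoiding d t (rest x))) \<le> M ^ t * (1 + real (card (rest x))) ^ \<theta>" for x
    unfolding M_def q_def using Suc.prems by (intro Suc.IH) (auto simp: rest_def)
  \<comment> \<open>Remove the first pair x: all later points lie off its hyperplane, hence in
    \<open>rest x\<close>.\<close>
  have "avoiding d (Suc t) A \<subseteq> (\<Union>x\<in>F. (#) x ` avoiding d t (rest x))"
  proof
    fix xs assume xs: "xs \<in> avoiding d (Suc t) A"
    then obtain x ys where "xs = x # ys"
      by (cases xs) (auto simp: avoiding_def)
    with xs have "x \<in> F" "ys \<in> avoiding d t (rest x)"
      by (auto simp: avoiding_def F_def rest_def)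
    with \<open>xs = x # ys\<close> show "xs \<in> (\<Union>x\<in>F. (#) x ` avoiding d t (rest x))"
      by blast
  qed
  then have "card (avoiding d (Suc t) A) \<le> card (\<Union>x\<in>F. (#) x ` avoiding d t (rest x))"
    using fin finite_avoiding by (intro card_mono finite_UN_I finite_imageI)
  also have "\<dots> \<le> (\<Sum>x\<in>F. card ((#) x ` avoiding d t (rest x)))"
    by (rule card_UN_le[OF fin(3)])
  also have "\<dots> \<le> (\<Sum>x\<in>F. card (avoiding d t (rest x)))"
    by (intro sum_mono card_image_le finite_avoiding)
  finally have "real (card (avoiding d (Suc t) A)) \<le> (\<Sum>x\<in>F. real (card (avoiding d t (rest x))))"
    unfolding of_nat_sum[symmetric] by (rule of_nat_mono)
  also have "\<dots> = (\<Sum>x\<in>F - P. real (card (avoiding d t (rest x)))) + (\<Sum>x\<in>P. real (card (avoiding d t (rest x))))"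
    using fin by (intro sum.subset_diff) (auto simp: P_def)
  \<comment> \<open>For poor hyperplanes the potential is merely bounded by its old value; the gain
    is the small number of pairs, given by \<open>card_poor_hyperplanes\<close>.\<close>
  also have "(\<Sum>x\<in>P. real (card (avoiding d t (rest x)))) \<le> real (card P) * (M ^ t * (1 + real (card A)) ^ \<theta>)"
  proof (rule sum_bounded_above)
    fix x
    have "card (rest x) \<le> card A"
      using fin by (intro card_mono) (auto simp: rest_def)
    then have "M ^ t * (1 + real (card (rest x))) ^ \<theta> \<le> M ^ t * (1 + real (card A)) ^ \<theta>"
      using M by (intro mult_left_mono power_mono) auto
    with IH[of x] show "real (card (avoiding d t (rest x))) \<le> M ^ t * (1 + real (card A)) ^ \<theta>"
      by linarith
  qed
  also have "real (card P) * (M ^ t * (1 + real (card A)) ^ \<theta>) \<le> 4 * q ^ (d + 2) * (M ^ t * (1 + real (card A)) ^ \<theta>)"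
  proof (rule mult_right_mono)
    have "card P \<le> card (A \<times> B)"
      using fin by (intro card_mono) (auto simp: P_def F_def)
    then have "real (card P) \<le> real (card B) * real (card A)"
      unfolding of_nat_mult[symmetric] card_cartesian_product by (intro of_nat_mono) (simp add: mult.commute)
    also have "\<dots> \<le> 4 * q ^ (d + 2)"
      unfolding B_def q_def using Suc.prems d
      by (intro card_poor_hyperplanes) (auto simp: nonzero_vecs_def)
    finally show "real (card P) \<le> 4 * q ^ (d + 2)" .
  qed (use M in auto)
  also have "(\<Sum>x\<in>F - P. real (card (avoiding d t (rest x))))
      \<le> real (card (F - P)) * (M ^ t * ((1 - 1 / (4 * q)) ^ \<theta> * (1 + real (card A)) ^ \<theta>))"
  proof (rule sum_bounded_above)
    fix x assume x: "x \<in> F - P"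
    then have "fst x \<in> A" "snd x \<in> vecs d"
      by (auto simp: F_def antiflags_def)
    then have "card A \<ge> 1"
      using fin(1) by (metis One_nat_def Suc_leI card_gt_0_iff empty_iff)
    have "card A \<le> 2 * card K * card {a \<in> A. dot d (snd x) a = 0}"
      using x \<open>snd x \<in> vecs d\<close> by (auto simp: P_def B_def)
    then have "real (card A) \<le> 2 * q * real (card {a \<in> A. dot d (snd x) a = 0})"
      unfolding q_def using of_nat_mono[where 'a = real] by fastforce
    moreover have "card A = card (rest x) + card {a \<in> A. dot d (snd x) a = 0}"
      using fin unfolding rest_def
      by (subst card_Un_disjoint[symmetric]) (auto intro: arg_cong[where f = card])
    then have "real (card A) = real (card (rest x)) + real (card {a \<in> A. dot d (snd x) a = 0})"
      by simp
    ultimately have "2 * q * real (card (rest x)) \<le> (2 * q - 1) * real (card A)"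
      by (simp add: algebra_simps)
    \<comment> \<open>A hyperplane that is not poor removes at least a fraction 1/(2q) of A. Passing
      from |A| to 1 + |A| weakens this to 1/(4q), which uses that A is nonempty. The added 1 keeps
      the potential at least 1 even for empty A, as the base case demands.\<close>
    then have "4 * q * (1 + real (card (rest x))) \<le> (4 * q - 1) * (1 + real (card A))"
      using \<open>card A \<ge> 1\<close> by (simp add: algebra_simps)
    then have "1 + real (card (rest x)) \<le> (1 - 1 / (4 * q)) * (1 + real (card A))"
      using q by (simp add: field_simps)
    then have "(1 + real (card (rest x))) ^ \<theta> \<le> (1 - 1 / (4 * q)) ^ \<theta> * (1 + real (card A)) ^ \<theta>"
      unfolding power_mult_distrib[symmetric] by (intro power_mono) auto
    then have "M ^ t * (1 + real (card (rest x))) ^ \<theta> \<le> M ^ t * ((1 - 1 / (4 * q)) ^ \<theta> * (1 + real (card A)) ^ \<theta>)"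
      using M by (intro mult_left_mono) auto
    with IH[of x] show "real (card (avoiding d t (rest x)))
        \<le> M ^ t * ((1 - 1 / (4 * q)) ^ \<theta> * (1 + real (card A)) ^ \<theta>)"
      by linarith
  qed
  also have "\<dots> \<le> q ^ (2 * d) * (M ^ t * ((1 - 1 / (4 * q)) ^ \<theta> * (1 + real (card A)) ^ \<theta>))"
  proof (rule mult_right_mono)
    have "card (F - P) \<le> card (antiflags d)"
      by (intro card_mono finite_antiflags) (auto simp: F_def)
    also note card_antiflags_le
    finally show "real (card (F - P)) \<le> q ^ (2 * d)"
      unfolding q_def of_nat_power[symmetric] by (rule of_nat_mono)
  qed (use M q in auto)
  also have "\<dots> = (q ^ (2 * d) * (1 - 1 / (4 * q)) ^ \<theta>) * (M ^ t * (1 + real (card A)) ^ \<theta>)"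
    by (simp add: mult_ac)
  also have "\<dots> \<le> 1 * (M ^ t * (1 + real (card A)) ^ \<theta>)"
    using \<theta> M unfolding q_def by (intro mult_right_mono) auto
  also have "1 * (M ^ t * (1 + real (card A)) ^ \<theta>) + 4 * q ^ (d + 2) * (M ^ t * (1 + real (card A)) ^ \<theta>)
      = (1 + 4 * q ^ (d + 2)) * (M ^ t * (1 + real (card A)) ^ \<theta>)"
    by (simp add: algebra_simps)
  \<comment> \<open>The summand 1 pays for all choices that are not poor and 4q^(d+2) for the poor
    ones; together they explain the constant 5.\<close>
  also have "\<dots> \<le> M * (M ^ t * (1 + real (card A)) ^ \<theta>)"
  proof (rule mult_right_mono)
    have "1 \<le> q ^ (d + 2)"
      using q by (intro one_le_power) auto
    then show "1 + 4 * q ^ (d + 2) \<le> M"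
      by (simp add: M_def)
  qed (use M in auto)
  finally show ?case
    by (simp add: M_def q_def mult_ac)
qed

text \<open>Linear independence of the points, expressed by counting: taking linear combinations
  maps the coefficient families \<open>I \<rightarrow>\<^sub>E K\<close> injectively into
  \<open>vecs d\<close>, so |K|^|I| is at most |K|^d.\<close>

lemma card_triangular_le:
  fixes I :: "nat set"
  assumes "finite I" and v: "\<And>i. i \<in> I \<Longrightarrow> v i \<in> antiflags d"
    and tri: "\<And>i j. i \<in> I \<Longrightarrow> j \<in> I \<Longrightarrow> i < j \<Longrightarrow> dot d (snd (v i)) (fst (v j)) = 0"
  shows "card I \<le> d"
proof -
  define f where "f c = (\<lambda>l\<in>{..<d}. \<Sum>j\<in>I. c j * fst (v j) l)" for c
  have dot_f: "dot d \<alpha> (f c) = (\<Sum>j\<in>I. c j * dot d \<alpha> (fst (v j)))" for \<alpha> c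
    unfolding dot_def f_def by (simp add: sum_distrib_left mult_ac) (rule sum.swap)
  have "card (I \<rightarrow>\<^sub>E K) \<le> card (vecs d)"
  proof (rule card_inj_on_le[where f = f])
    show "inj_on f (I \<rightarrow>\<^sub>E K)"
    proof
      fix b c assume bc: "b \<in> I \<rightarrow>\<^sub>E K" "c \<in> I \<rightarrow>\<^sub>E K" "f b = f c"
      show "b = c"
      proof (rule ccontr)
        define D where "D = {i \<in> I. b i \<noteq> c i}"
        assume "b \<noteq> c"
        then have "D \<noteq> {}" "finite D"
          using bc assms(1) PiE_ext[of b I "\<lambda>_. K" c] by (auto simp: D_def)
        \<comment> \<open>Pair both combinations with the hyperplane of the least index where the
          coefficients differ. Terms before i cancel by minimality, terms after i vanish by
          \<open>tri\<close>, and the diagonal term is nonzero.\<close>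
        define i where "i = Min D"
        have i: "i \<in> I" "b i \<noteq> c i"
          using Min_in[OF \<open>finite D\<close> \<open>D \<noteq> {}\<close>] by (auto simp: D_def i_def)
        have "(b j - c j) * dot d (snd (v i)) (fst (v j)) = 0" if j: "j \<in> I - {i}" for j
        proof (cases "j < i")
          case True
          then have "j \<notin> D"
            using Min_le[OF \<open>finite D\<close>, of j] by (auto simp: i_def)
          with j show ?thesis
            by (simp add: D_def)
        next
          case False
          with j i tri[of i j] show ?thesis
            by simp
        qed
        then have "(\<Sum>j\<in>I. (b j - c j) * dot d (snd (v i)) (fst (v j)))
            = (b i - c i) * dot d (snd (v i)) (fst (v i))"
          using assms(1) i by (subst sum.remove[of _ i], simp, simp, subst sum.neutral) auto
        moreover have "dot d (snd (v i)) (f b) - dot d (snd (v i)) (f c) = 0"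
          using bc(3) by simp
        ultimately have "(b i - c i) * dot d (snd (v i)) (fst (v i)) = 0"
          by (simp add: dot_f left_diff_distrib sum_subtractf)
        with i v[of i] show False
          by (simp add: antiflags_def)
      qed
    qed
    show "f ` (I \<rightarrow>\<^sub>E K) \<subseteq> vecs d"
    proof (rule image_subsetI)
      fix c assume c: "c \<in> I \<rightarrow>\<^sub>E K"
      show "f c \<in> vecs d"
        unfolding vecs_def f_def restrict_PiE_iff
      proof (intro ballI sum_K mult_K)
        fix l j assume "l \<in> {..<d}" "j \<in> I"
        then show "c j \<in> K" "fst (v j) l \<in> K"
          using c v[of j] vecs_in_K by (auto simp: antiflags_def)
      qed
    qed
  qed (rule finite_vecs)
  then have "card K ^ card I \<le> card K ^ d"
    using assms(1) by (simp add: card_PiE card_vecs)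
  then show ?thesis
    using card_K_ge_2 power_le_imp_le_exp[of "card K" "card I" d] by simp
qed

end

section \<open>The random graph\<close>

text \<open>k^k / k! is a single term of the series for exp k, and e is at most 3. It turns the
  bound N^k / k! on the binomial coefficient into (3N/k)^k.\<close>

lemma power_self_le_exp_fact: "real k ^ k \<le> 3 ^ k * fact k"
proof -
  have "(\<lambda>n. real k ^ n / fact n) sums exp (real k)"
    using exp_converges[of "real k"] by (simp add: field_simps)
  then have "real k ^ k / fact k \<le> exp (real k)"
    using sum_le_suminf[of "\<lambda>n. real k ^ n / fact n" "{k}"] by (auto simp: sums_iff)
  also have "\<dots> = exp 1 ^ k"
    by (simp flip: exp_of_nat_mult)
  also have "\<dots> \<le> 3 ^ k"
    using exp_le by (intro power_mono) auto
  finally show ?thesis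
    by (simp add: field_simps)
qed

text \<open>The union bound as a count: each k-set I is bad for at most |T| * |V|^(N-k) of the |V|^N
  maps, so by \<open>less\<close> the bad maps cannot exhaust all of them.\<close>

lemma exists_map_avoiding:
  fixes V :: "'b set"
  assumes V: "finite V" "V \<noteq> {}" and T: "finite T"
    and less: "(N choose k) * card T < card V ^ k"
  shows "\<exists>v \<in> {..<N} \<rightarrow>\<^sub>E V. \<forall>I \<subseteq> {..<N}. card I = k \<longrightarrow> map v (sorted_list_of_set I) \<notin> T"
proof (rule ccontr)
  assume contra: "\<not> ?thesis"
  define bad where "bad I = {v \<in> {..<N} \<rightarrow>\<^sub>E V. map v (sorted_list_of_set I) \<in> T}" for I
  have fin: "finite ({..<N} \<rightarrow>\<^sub>E V)"
    using V by (intro finite_PiE) auto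
  have bad: "card (bad I) \<le> card T * card V ^ (N - k)" if I: "I \<in> [{..<N}]\<^bsup>k\<^esup>" for I
  proof -
    have I': "I \<subseteq> {..<N}" "card I = k" "finite I"
      using I by (auto simp: nsets_def)
    define J where "J = {..<N} - I"
    have "card (bad I) \<le> card (T \<times> (J \<rightarrow>\<^sub>E V))"
    \<comment> \<open>A bad map is determined by its list of values along I, an element of T, and
      its restriction to the complement.\<close>
    proof (rule card_inj_on_le[where f = "\<lambda>v. (map v (sorted_list_of_set I), restrict v J)"])
      show "inj_on (\<lambda>v. (map v (sorted_list_of_set I), restrict v J)) (bad I)"
      proof
        fix v w assume vw: "v \<in> bad I" "w \<in> bad I"
          "(map v (sorted_list_of_set I), restrict v J) = (map w (sorted_list_of_set I), restrict w J)"
        then have eqs: "map v (sorted_list_of_set I) = map w (sorted_list_of_set I)"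
            "restrict v J = restrict w J"
          by blast+
        show "v = w"
        proof (rule PiE_ext)
          show "v \<in> {..<N} \<rightarrow>\<^sub>E V" "w \<in> {..<N} \<rightarrow>\<^sub>E V"
            using vw unfolding bad_def by blast+
        next
          fix i assume "i \<in> {..<N}"
          then consider "i \<in> I" | "i \<in> J"
            by (auto simp: J_def)
          then show "v i = w i"
          proof cases
            case 1
            with eqs(1) I' show ?thesis
              unfolding map_eq_conv by simp
          next
            case 2
            with fun_cong[OF eqs(2), of i] show ?thesis
              by simp
          qed
        qed
      qed
      show "(\<lambda>v. (map v (sorted_list_of_set I), restrict v J)) ` bad I \<subseteq> T \<times> (J \<rightarrow>\<^sub>E V)"
        unfolding image_subset_iff mem_Times_iff fst_conv snd_conv restrict_PiE_iff
        by (auto simp only: bad_def J_def)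
      show "finite (T \<times> (J \<rightarrow>\<^sub>E V))"
        using T V by (intro finite_cartesian_product finite_PiE) (auto simp: J_def)
    qed
    also have "\<dots> = card T * card V ^ (N - k)"
      using I' by (simp add: card_cartesian_product card_PiE J_def card_Diff_subset)
    finally show ?thesis .
  qed
  have "({..<N} \<rightarrow>\<^sub>E V) \<subseteq> (\<Union>I\<in>[{..<N}]\<^bsup>k\<^esup>. bad I)"
  proof
    fix v assume v: "v \<in> {..<N} \<rightarrow>\<^sub>E V"
    with contra obtain I where "I \<subseteq> {..<N}" "card I = k" "map v (sorted_list_of_set I) \<in> T"
      by blast
    with v show "v \<in> (\<Union>I\<in>[{..<N}]\<^bsup>k\<^esup>. bad I)"
      unfolding bad_def nsets_def by (blast intro: finite_subset)
  qed
  then have "card ({..<N} \<rightarrow>\<^sub>E V) \<le> card (\<Union>I\<in>[{..<N}]\<^bsup>k\<^esup>. bad I)"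
    using fin by (intro card_mono finite_UN_I finite_imp_finite_nsets) (simp_all add: bad_def)
  also have "\<dots> \<le> (\<Sum>I\<in>[{..<N}]\<^bsup>k\<^esup>. card (bad I))"
    by (intro card_UN_le finite_imp_finite_nsets) simp
  also have "\<dots> \<le> card ([{..<N}]\<^bsup>k\<^esup>) * (card T * card V ^ (N - k))"
    using sum_bounded_above[OF bad, of "[{..<N}]\<^bsup>k\<^esup>"] by simp
  finally have *: "card V ^ N \<le> (N choose k) * card T * card V ^ (N - k)"
    by (simp add: card_PiE mult.assoc)
  show False
  proof (cases "k \<le> N")
    case True
    have "card V ^ k * card V ^ (N - k) \<le> (N choose k) * card T * card V ^ (N - k)"
      using * True by (simp flip: power_add)
    moreover have "0 < card V ^ (N - k)"
      using V by (simp add: card_gt_0_iff)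
    ultimately have "card V ^ k \<le> (N choose k) * card T"
      by (simp only: mult_le_cancel2)
    with less show False
      by simp
  next
    case False
    \<comment> \<open>There is no k-subset here, so the supposed covering by bad sets is empty,
      although at least one map exists.\<close>
    then have "N choose k = 0"
      by (simp add: binomial_eq_0)
    with * V show False
      by simp
  qed
qed

context finite_subfield
begin

text \<open>Apply \<open>exists_map_avoiding\<close> to antiflags. In the resulting graph a clique
  is a triangular system, bounded by \<open>card_triangular_le\<close>; an independent k-set listed
  in increasing order would be an excluded avoiding list.\<close>

lemma not_ramsey_prop:
  assumes d: "d \<ge> 2"
    and less: "(N choose k) * card (avoiding d k (nonzero_vecs d)) < card (antiflags d) ^ k"
  shows "\<not> ramsey_prop (d + 1) k N"
proof
  assume ramsey: "ramsey_prop (d + 1) k N"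
  have "0 < card K ^ (2 * d)"
    using card_K_ge_2 by simp
  then have "antiflags d \<noteq> {}"
    using card_antiflags_ge[of d] d by auto
  then obtain v where v: "v \<in> {..<N} \<rightarrow>\<^sub>E antiflags d"
    and avoid: "\<And>I. I \<subseteq> {..<N} \<Longrightarrow> card I = k \<Longrightarrow>
      map v (sorted_list_of_set I) \<notin> avoiding d k (nonzero_vecs d)"
    using exists_map_avoiding[OF finite_antiflags _ finite_avoiding less] by blast
  have v_mem: "v i \<in> antiflags d" if "i < N" for i
    using v that by auto
  \<comment> \<open>The order i < j selects which of the two incidences decides adjacency, since the
    relation itself is not symmetric.\<close>
  define E where "E = {{i, j} | i j. i < j \<and> j < N \<and> dot d (snd (v i)) (fst (v j)) = 0}"
  have E_iff: "{i, j} \<in> E \<longleftrightarrow> dot d (snd (v i)) (fst (v j)) = 0" if "i < j" "j < N" for i j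
    using that by (auto simp: E_def doubleton_eq_iff)
  have "is_graph {0..<N} E"
    by (auto simp: is_graph_def E_def)
  with ramsey consider S where "S \<subseteq> {0..<N}" "card S = d + 1" "is_clique E S"
    | S where "S \<subseteq> {0..<N}" "card S = k" "is_indep E S"
    unfolding ramsey_prop_def by blast
  then show False
  proof cases
    case 1
    have "card S \<le> d"
    proof (rule card_triangular_le)
      show "finite S"
        using 1(1) finite_subset by blast
      show "v i \<in> antiflags d" if "i \<in> S" for i
        using that 1(1) by (intro v_mem) auto
      show "dot d (snd (v i)) (fst (v j)) = 0" if "i \<in> S" "j \<in> S" "i < j" for i j
      proof -
        have "{i, j} \<in> E"
          using that 1(3) by (auto simp: is_clique_def)
        moreover have "j < N"
          using that 1(1) by auto
        ultimately show ?thesis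
          using E_iff that by blast
      qed
    qed
    with 1 show False
      by simp
  next
    case 2
    have S: "S \<subseteq> {..<N}" "finite S"
      using 2(1) finite_subset by (auto simp: lessThan_atLeast0)
    have "sorted_wrt (\<lambda>i j. dot d (snd (v i)) (fst (v j)) \<noteq> 0) (sorted_list_of_set S)"
    proof (rule sorted_wrt_mono_rel[OF _ strict_sorted_list_of_set])
      fix i j assume "i \<in> set (sorted_list_of_set S)" "j \<in> set (sorted_list_of_set S)" "i < j"
      moreover from this have "i \<in> S" "j \<in> S"
        using S by simp_all
      ultimately have "j < N" "{i, j} \<notin> E"
        using S 2(3) by (auto simp: is_indep_def)
      with \<open>i < j\<close> show "dot d (snd (v i)) (fst (v j)) \<noteq> 0"
        using E_iff by blast
    qed
    moreover have "v i \<in> antiflags d \<inter> nonzero_vecs d \<times> UNIV" if "i \<in> S" for i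
      using that S(1) v_mem[of i] fst_antiflags[of "v i"] by (auto simp: mem_Times_iff)
    ultimately have "map v (sorted_list_of_set S) \<in> avoiding d k (nonzero_vecs d)"
      using S(2) 2(2) by (simp add: avoiding_def sorted_wrt_map image_subset_iff)
    with avoid S 2(2) show False
      by blast
  qed
qed

text \<open>The constant 120 is 3 * 10 * 4: 3 from the binomial bound, 10 = 5 * 2 from
  \<open>card_avoiding_le\<close> and the initial potential, and 4 from
  \<open>card_antiflags_ge\<close>.\<close>

lemma few_avoiding:
  assumes d: "d \<ge> 2" and K: "card K = 2 ^ m" and m: "8 * d\<^sup>2 * m\<^sup>2 * 2 ^ m \<le> k"
    and k: "k > 0" and N: "120 * N < k * 2 ^ (m * (d - 2))"
  shows "(N choose k) * card (avoiding d k (nonzero_vecs d)) < card (antiflags d) ^ k"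
proof -
  define q where "q = real (card K)"
  \<comment> \<open>Chosen so that \<theta>/(4q) = 2dm: then (1 - 1/(4q))^\<theta> is at most
    exp(-2dm), which offsets q^(2d) = 2^(2dm).\<close>
  define \<theta> where "\<theta> = 8 * 2 ^ m * d * m"
  have "real 2 \<le> q"
    unfolding q_def by (intro of_nat_mono card_K_ge_2)
  then have q: "q \<ge> 2" "q = 2 ^ m"
    by (simp_all add: q_def K)
  have "q ^ (2 * d) = 2 ^ (2 * d * m)"
    unfolding q(2) by (simp add: mult_ac flip: power_mult)
  also have "(2 :: real) ^ (2 * d * m) \<le> exp 1 ^ (2 * d * m)"
    using exp_ge_add_one_self[of 1] by (intro power_mono) auto
  also have "\<dots> = exp (real (2 * d * m))"
    by (simp flip: exp_of_nat_mult)
  finally have 1: "q ^ (2 * d) \<le> exp (real (2 * d * m))" .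
  have "(1 - 1 / (4 * q)) ^ \<theta> \<le> exp (- 1 / (4 * q)) ^ \<theta>"
    using q exp_ge_add_one_self[of "- 1 / (4 * q)"] by (intro power_mono) auto
  also have "\<dots> = exp (- (real (2 * d * m)))"
    unfolding exp_of_nat_mult[symmetric] \<theta>_def using q by simp
  finally have "q ^ (2 * d) * (1 - 1 / (4 * q)) ^ \<theta> \<le> exp (real (2 * d * m)) * exp (- (real (2 * d * m)))"
    using 1 q by (intro mult_mono) auto
  also have "\<dots> = 1"
    by (simp flip: exp_add)
  finally have \<theta>: "q ^ (2 * d) * (1 - 1 / (4 * q)) ^ \<theta> \<le> 1" .
  have "1 + real (card (nonzero_vecs d)) = q ^ d"
    unfolding q_def of_nat_power[symmetric] card_nonzero_vecs[symmetric] by simp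
  then have "real (card (avoiding d k (nonzero_vecs d))) \<le> (5 * q ^ (d + 2)) ^ k * (q ^ d) ^ \<theta>"
    using card_avoiding_le[OF d \<theta>[unfolded q_def] subset_refl, of k] by (simp add: q_def)
  also have "\<dots> \<le> (5 * q ^ (d + 2)) ^ k * 2 ^ k"
  proof (rule mult_left_mono)
    \<comment> \<open>The lower bound \<open>m\<close> on k makes the initial potential cost at most
      a factor 2 per list entry.\<close>
    have "(q ^ d) ^ \<theta> = 2 ^ (8 * d\<^sup>2 * m\<^sup>2 * 2 ^ m)"
      unfolding q(2) \<theta>_def power_mult[symmetric] by (simp add: power2_eq_square mult_ac)
    also have "(2 :: real) ^ (8 * d\<^sup>2 * m\<^sup>2 * 2 ^ m) \<le> 2 ^ k"
      using m by (intro power_increasing) auto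
    finally show "(q ^ d) ^ \<theta> \<le> 2 ^ k" .
  qed (use q in auto)
  also have "\<dots> = (10 * q ^ (d + 2)) ^ k"
    unfolding power_mult_distrib[symmetric] by simp
  finally have avoid: "real (card (avoiding d k (nonzero_vecs d))) \<le> (10 * q ^ (d + 2)) ^ k" .
  have "real (N choose k) * fact k \<le> real N ^ k"
    using of_nat_mono[OF binomial_fact_pow[of N k], where 'a = real] by simp
  then have "real (N choose k) * (3 ^ k * fact k) \<le> (3 * real N) ^ k"
    by (simp add: power_mult_distrib mult_ac)
  moreover have "real (N choose k) * real k ^ k \<le> real (N choose k) * (3 ^ k * fact k)"
    by (intro mult_left_mono power_self_le_exp_fact) auto
  ultimately have "real (N choose k) * real k ^ k \<le> (3 * real N) ^ k"
    by linarith
  then have choose: "real (N choose k) \<le> (3 * real N / real k) ^ k"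
    using k by (simp add: field_simps)
  have "real (N choose k) * real (card (avoiding d k (nonzero_vecs d)))
      \<le> (3 * real N / real k) ^ k * (10 * q ^ (d + 2)) ^ k"
    using choose avoid by (intro mult_mono) auto
  also have "\<dots> = (3 * real N / real k * (10 * q ^ (d + 2))) ^ k"
    by (rule power_mult_distrib[symmetric])
  also have "\<dots> < (q ^ (2 * d) / 4) ^ k"
  proof (rule power_strict_mono)
    have "real (120 * N) < real (k * 2 ^ (m * (d - 2)))"
      using N by (simp only: of_nat_less_iff)
    then have "120 * real N < real k * q ^ (d - 2)"
      by (simp add: q(2) flip: power_mult)
    then have "120 * real N * q ^ (d + 2) < real k * q ^ (d - 2) * q ^ (d + 2)"
      using q by (intro mult_strict_right_mono) auto
    also have "\<dots> = real k * q ^ ((d - 2) + (d + 2))"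
      by (simp only: power_add mult.assoc)
    also have "(d - 2) + (d + 2) = 2 * d"
      using d by simp
    finally show "3 * real N / real k * (10 * q ^ (d + 2)) < q ^ (2 * d) / 4"
      using k by (simp add: field_simps)
  qed (use q k in auto)
  also have "\<dots> \<le> real (card (antiflags d)) ^ k"
  proof (rule power_mono)
    have "real (card K ^ (2 * d)) \<le> real (4 * card (antiflags d))"
      using d card_antiflags_ge[of d] by (intro of_nat_mono) auto
    then show "q ^ (2 * d) / 4 \<le> real (card (antiflags d))"
      by (simp add: q_def)
  qed (use q in auto)
  finally have "real ((N choose k) * card (avoiding d k (nonzero_vecs d))) < real (card (antiflags d) ^ k)"
    by simp
  then show ?thesis
    by (simp only: of_nat_less_iff)
qed

end

section \<open>Ramsey numbers\<close>

text \<open>The \<open>LEAST\<close> is attained because the finite Ramsey theorem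
  \<open>ramsey2\<close> provides some suitable n.\<close>

lemma ramsey_prop_ramsey_number: "ramsey_prop s k (ramsey_number s k)"
proof -
  obtain r where r: "\<And>(V :: nat set) E. finite V \<Longrightarrow> card V \<ge> r \<Longrightarrow>
      \<exists>R \<subseteq> V. card R = s \<and> clique R E \<or> card R = k \<and> indep R E"
    using ramsey2[of s k] by blast
  have "ramsey_prop s k r"
    unfolding ramsey_prop_def
  proof (intro allI impI)
    fix E
    obtain R where "R \<subseteq> {0..<r}" "card R = s \<and> clique R E \<or> card R = k \<and> indep R E"
      using r[of "{0..<r}" E] by auto
    then show "(\<exists>S\<subseteq>{0..<r}. card S = s \<and> is_clique E S) \<or> (\<exists>S\<subseteq>{0..<r}. card S = k \<and> is_indep E S)"
      unfolding is_clique_def is_indep_def clique_def indep_def by blast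
  qed
  then show ?thesis
    unfolding ramsey_number_def by (rule LeastI)
qed

lemma ramsey_number_pos:
  assumes "s > 0" "k > 0"
  shows "ramsey_number s k > 0"
proof (rule ccontr)
  assume "\<not> ?thesis"
  then have "ramsey_prop s k 0"
    using ramsey_prop_ramsey_number[of s k] by simp
  moreover have "is_graph {0..<0} {}"
    by (simp add: is_graph_def)
  ultimately show False
    using assms unfolding ramsey_prop_def by fastforce
qed

text \<open>If the bound failed, \<open>not_ramsey_prop\<close> could be applied with N equal to the
  Ramsey number itself, where \<open>ramsey_prop\<close> holds.\<close>

lemma ramsey_number_ge_power_2:
  assumes "d \<ge> 2" "m > 0" "8 * d\<^sup>2 * m\<^sup>2 * 2 ^ m \<le> k"
  shows "k * 2 ^ (m * (d - 2)) \<le> 120 * ramsey_number (d + 1) k"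
proof (rule ccontr)
  assume less: "\<not> ?thesis"
  obtain K :: "bit alg_closure set" where K: "finite_subfield K" "card K = 2 ^ m"
    using exists_finite_subfield_card_2_power[OF assms(2)] by blast
  interpret finite_subfield K
    by (rule K)
  have "0 < 8 * d\<^sup>2 * m\<^sup>2 * 2 ^ m"
    using assms by simp
  with assms have "k > 0"
    by linarith
  then have "\<not> ramsey_prop (d + 1) k (ramsey_number (d + 1) k)"
    using assms less K by (intro not_ramsey_prop few_avoiding) auto
  with ramsey_prop_ramsey_number show False
    by blast
qed

text \<open>Take the largest m with f m at most k; the first assumption says that m = 1 qualifies.
  Maximality gives k < f (m + 1), so 2^m has order at least k / (ln k)^2.\<close>

lemma exists_optimal_exponent:
  fixes d k :: nat
  assumes "16 * d\<^sup>2 \<le> k" and "d > 0"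
  obtains m where "m > 0" "8 * d\<^sup>2 * m\<^sup>2 * 2 ^ m \<le> k"
    "real k \<le> 256 * (real d)\<^sup>2 * (ln (real k))\<^sup>2 * 2 ^ m"
proof -
  define f where "f m = 8 * d\<^sup>2 * m\<^sup>2 * 2 ^ m" for m
  define m where "m = (GREATEST m. f m \<le> k)"
  have bound: "m \<le> k" if "f m \<le> k" for m
  proof (cases "m = 0")
    case False
    have "m \<le> 2 ^ m"
      using less_exp[of m] by simp
    also have "\<dots> \<le> f m"
      using False assms by (simp add: f_def)
    finally show ?thesis
      using that by simp
  qed simp
  have f1: "f 1 \<le> k"
    using assms by (simp add: f_def)
  have fm: "f m \<le> k"
    unfolding m_def by (rule GreatestI_nat[of "\<lambda>m. f m \<le> k", OF f1 bound])
  have "1 \<le> m"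
    unfolding m_def by (rule Greatest_le_nat[of "\<lambda>m. f m \<le> k", OF f1 bound])
  have "k < f (m + 1)"
  proof (rule ccontr)
    assume "\<not> k < f (m + 1)"
    then have "m + 1 \<le> m"
      unfolding m_def by (intro Greatest_le_nat[of "\<lambda>m. f m \<le> k", OF _ bound]) auto
    then show False
      by simp
  qed
  \<comment> \<open>As m is at least 1, m + 1 is at most 2m, so f grows by a factor of at most 2 * 4
    = 8.\<close>
  also have "f (m + 1) \<le> 64 * d\<^sup>2 * m\<^sup>2 * 2 ^ m"
  proof -
    have "(m + 1)\<^sup>2 \<le> (2 * m)\<^sup>2"
      using \<open>1 \<le> m\<close> by (intro power_mono) auto
    then have "(16 * d\<^sup>2 * 2 ^ m) * (m + 1)\<^sup>2 \<le> (16 * d\<^sup>2 * 2 ^ m) * (2 * m)\<^sup>2"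
      by (rule mult_left_mono) simp
    then show ?thesis
      by (simp add: f_def power_mult_distrib mult_ac)
  qed
  finally have "real k \<le> real (64 * d\<^sup>2 * m\<^sup>2 * 2 ^ m)"
    by (intro of_nat_mono) simp
  also have "\<dots> = 64 * (real d)\<^sup>2 * 2 ^ m * (real m)\<^sup>2"
    by simp
  also have "\<dots> \<le> 64 * (real d)\<^sup>2 * 2 ^ m * (2 * ln (real k))\<^sup>2"
  proof (intro mult_left_mono power_mono)
    have "2 ^ m \<le> f m"
      using \<open>1 \<le> m\<close> assms by (simp add: f_def)
    then have "real (2 ^ m) \<le> real k"
      using fm by (intro of_nat_mono) linarith
    then have "ln (2 ^ m) \<le> ln (real k)"
      by (intro ln_mono) simp_all
    then have "real m * ln 2 \<le> ln (real k)"
      by (simp add: ln_realpow)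
    moreover have "real m * (1 / 2) \<le> real m * ln 2"
      using ln2_ge_two_thirds by (intro mult_left_mono) auto
    ultimately show "real m \<le> 2 * ln (real k)"
      by linarith
  qed auto
  also have "\<dots> = 256 * (real d)\<^sup>2 * (ln (real k))\<^sup>2 * 2 ^ m"
    by (simp add: power_mult_distrib)
  finally show thesis
    using that[of m] \<open>1 \<le> m\<close> fm by (simp add: f_def)
qed

theorem theorem1p1:
  fixes s :: nat
  assumes "s \<ge> 4"
  shows "\<exists>c > 0. \<forall>k::nat. k \<ge> 2 \<longrightarrow>
           real (ramsey_number s k) \<ge> c * real k ^ (s - 2) / (ln (real k)) ^ (2 * s - 6)"
proof -
  define d where "d = s - 1"
  define e where "e = s - 3"
  have s: "s = d + 1" "d - 2 = e" "s - 2 = Suc e" "2 * s - 6 = 2 * e" "d \<ge> 2"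
    using assms by (auto simp: d_def e_def)
  define D where "D = 256 * (real d)\<^sup>2"
  have D: "D > 0"
    using s by (simp add: D_def)
  \<comment> \<open>The first entry serves large k, with 120 from
    \<open>ramsey_number_ge_power_2\<close>; the second serves the finitely many k below 16
    d^2.\<close>
  define c where "c = min (1 / (120 * D ^ e)) (1 / (D ^ Suc e * 4 ^ e))"
  have "c > 0"
    using D by (simp add: c_def)
  moreover have "real (ramsey_number s k) \<ge> c * real k ^ (s - 2) / (ln (real k)) ^ (2 * s - 6)"
    if k: "k \<ge> 2" for k
  proof -
    define L where "L = (ln (real k))\<^sup>2"
    have "ln 2 \<le> ln (real k)"
      using k by simp
    then have ln: "1 / 2 \<le> ln (real k)"
      using ln2_ge_two_thirds by linarith
    then have "(1 / 2)\<^sup>2 \<le> L"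
      unfolding L_def by (intro power_mono) auto
    then have L: "1 / 4 \<le> L" "L > 0"
      by (simp_all add: power2_eq_square)
    have "c * real k ^ Suc e / L ^ e \<le> real (ramsey_number s k)"
    proof (cases "16 * d\<^sup>2 \<le> k")
      case True
      then obtain m where m: "m > 0" "8 * d\<^sup>2 * m\<^sup>2 * 2 ^ m \<le> k" "real k \<le> D * L * 2 ^ m"
        using exists_optimal_exponent[of d k] s unfolding D_def L_def by auto
      \<comment> \<open>With q = 2^m at least k/(DL), the bound k q^e / 120 becomes a multiple of
        k^(e+1) / L^e.\<close>
      have "real k ^ e \<le> (D * L * 2 ^ m) ^ e"
        using m by (intro power_mono) auto
      then have "real k * real k ^ e \<le> real k * (D * L * 2 ^ m) ^ e"
        by (intro mult_left_mono) auto
      also have "\<dots> = D ^ e * L ^ e * real (k * 2 ^ (m * e))"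
        by (simp add: power_mult_distrib mult_ac flip: power_mult)
      also have "\<dots> \<le> D ^ e * L ^ e * real (120 * ramsey_number s k)"
        using ramsey_number_ge_power_2[of d m k] m s D L
        by (intro mult_left_mono of_nat_mono) auto
      finally have "1 / (120 * D ^ e) * real k ^ Suc e / L ^ e \<le> real (ramsey_number s k)"
        using D L by (simp add: field_simps)
      moreover have "c * real k ^ Suc e / L ^ e \<le> 1 / (120 * D ^ e) * real k ^ Suc e / L ^ e"
        using L by (intro divide_right_mono mult_right_mono) (auto simp: c_def)
      ultimately show ?thesis
        by linarith
    next
      case False
      then have "real k \<le> real (256 * d\<^sup>2)"
        by (intro of_nat_mono) linarith
      then have "real k \<le> D"
        by (simp add: D_def)
      \<comment> \<open>Here k is at most D and 4L is at least 1, so the claimed lower bound is at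
        most 1 and positivity of the Ramsey number is enough.\<close>
      then have "real k ^ Suc e * 1 \<le> D ^ Suc e * (4 * L) ^ e"
        using L D by (intro mult_mono power_mono one_le_power) auto
      then have "1 / (D ^ Suc e * 4 ^ e) * real k ^ Suc e / L ^ e \<le> 1"
        using D L by (simp add: field_simps power_mult_distrib)
      moreover have "c * real k ^ Suc e / L ^ e \<le> 1 / (D ^ Suc e * 4 ^ e) * real k ^ Suc e / L ^ e"
        using L by (intro divide_right_mono mult_right_mono) (auto simp: c_def)
      moreover have "1 \<le> real (ramsey_number s k)"
        using ramsey_number_pos[of s k] k s by simp
      ultimately show ?thesis
        by linarith
    qed
    then show ?thesis
      unfolding s(3,4) L_def power_mult .
  qed
  ultimately show ?thesis
    by blast
qed

end
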